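(* Let $S$ be a bounded or unbounded distance set. If the group $\mathfrak S_{(\infty)}$ of all finitely supported permutations of $\mathbb N$ belongs to $\mathcal H(\mathbb U_S)$, then $|S|=2$ (that is, $\mathbb U_S$ is a countably infinite set with all distances between distinct points equal, and $\mathrm{Iso}(\mathbb U_S)\cong\mathfrak S_\infty$, the group of all permutations of $\mathbb N$).
   Context: Let $S\subseteq[0,+\infty[$ be a countable set containing $0$ and at least one other element. $S$ is an unbounded distance set if $s+t\in S$ for all $s,t\in S$; it is a bounded distance set if it has a maximum $M>0$ and $\min(s+t,M)\in S$ for all $s,t\in S$. An $S$-metric space is a metric space whose metric takes values in $S$. The $S$-Urysohn space $\mathbb U_S$ is the unique (up to isometry) countable $S$-metric space with the extension property: whenever $X\subseteq Y$ are finite $S$-metric spaces (with the restricted metric on $X$), every isometric embedding $X\to\mathbb U_S$ extends to an isometric embedding $Y\to\mathbb U_S$. $\mathrm{Iso}(\mathbb U_S)$ is its group of (surjective) isometries. An action of a group $\Gamma$ by isometries on $\mathbb U_S$ is homogeneous if for every isometry $\varphi$ between two finite subsets of $\mathbb U_S$ there is $\gamma\in\Gamma$ with $\gamma x=\varphi(x)$ for all $x\in\operatorname{dom}\varphi$. $\mathcal H(\mathbb U_S)$ is the class of countable groups which admit a faithful homogeneous action by isometries on $\mathbb U_S$ (equivalently, which are isomorphic to a dense subgroup of $\mathrm{Iso}(\mathbb U_S)$ for the topology of pointwise convergence, $\mathbb U_S$ being viewed as a discrete set). *)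

theory Defs
  imports "HOL-Analysis.Abstract_Metric_Spaces" "HOL-Algebra.Group_Action"
begin

section \<open>Distance sets\<close>

definition distance_values :: "real set \<Rightarrow> bool" where
  "distance_values S \<longleftrightarrow> S \<subseteq> {0..} \<and> countable S \<and> 0 \<in> S \<and> (\<exists>s\<in>S. s \<noteq> 0)"

definition unbounded_distance_set :: "real set \<Rightarrow> bool" where
  "unbounded_distance_set S \<longleftrightarrow> distance_values S \<and> (\<forall>s\<in>S. \<forall>t\<in>S. s + t \<in> S)"

definition bounded_distance_set :: "real set \<Rightarrow> bool" where
  "bounded_distance_set S \<longleftrightarrow> distance_values S \<and>
     (\<exists>M>0. M \<in> S \<and> (\<forall>s\<in>S. s \<le> M) \<and> (\<forall>s\<in>S. \<forall>t\<in>S. min (s + t) M \<in> S))"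


section \<open>Metric spaces with distances in a given set\<close>

definition S_metric_space :: "real set \<Rightarrow> 'a set \<Rightarrow> ('a \<Rightarrow> 'a \<Rightarrow> real) \<Rightarrow> bool" where
  "S_metric_space S X d \<longleftrightarrow> Metric_space X d \<and> (\<forall>x\<in>X. \<forall>y\<in>X. d x y \<in> S)"

definition isometric_embedding ::
    "'a set \<Rightarrow> ('a \<Rightarrow> 'a \<Rightarrow> real) \<Rightarrow> 'b set \<Rightarrow> ('b \<Rightarrow> 'b \<Rightarrow> real) \<Rightarrow> ('a \<Rightarrow> 'b) \<Rightarrow> bool" where
  "isometric_embedding X d Y e f \<longleftrightarrow>
     f ` X \<subseteq> Y \<and> (\<forall>x\<in>X. \<forall>y\<in>X. e (f x) (f y) = d x y)"

text \<open>
  The finite spaces in the extension property are carried by sets of natural numbers, since a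
  definition cannot quantify over types. This is no restriction: the lemma
  \<open>S_Urysohn_extension\<close> below gives the property for finite spaces of any type.
\<close>

definition S_Urysohn_space :: "real set \<Rightarrow> 'a set \<Rightarrow> ('a \<Rightarrow> 'a \<Rightarrow> real) \<Rightarrow> bool" where
  "S_Urysohn_space S U d \<longleftrightarrow> S_metric_space S U d \<and> countable U \<and>
     (\<forall>(Y :: nat set) e X f.
        finite Y \<and> S_metric_space S Y e \<and> X \<subseteq> Y \<and> isometric_embedding X e U d f \<longrightarrow>
        (\<exists>g. isometric_embedding Y e U d g \<and> (\<forall>x\<in>X. g x = f x)))"

lemma S_Urysohn_extension:
  fixes Y :: "'b set"
  assumes U: "S_Urysohn_space S U d"
    and Y: "finite Y" "S_metric_space S Y e" "X \<subseteq> Y"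
    and f: "isometric_embedding X e U d f"
  obtains g where "isometric_embedding Y e U d g" "\<And>x. x \<in> X \<Longrightarrow> g x = f x"
proof -
  obtain h :: "'b \<Rightarrow> nat" where h: "inj_on h Y"
    using \<open>finite Y\<close> by (meson countable_finite countableE)
  define k where "k = inv_into Y h"
  define e' where "e' = (\<lambda>i j. e (k i) (k j))"
  have k: "k (h y) = y" if "y \<in> Y" for y
    using that h by (simp add: k_def)
  interpret Metric_space Y e
    using Y by (simp add: S_metric_space_def)
  have "Metric_space (h ` Y) e'"
    by unfold_locales (auto simp: e'_def k intro: commute triangle)
  then have "S_metric_space S (h ` Y) e'"
    using Y by (auto simp: S_metric_space_def e'_def k)
  moreover have "isometric_embedding (h ` X) e' U d (f \<circ> k)"
    using f \<open>X \<subseteq> Y\<close> by (auto simp: isometric_embedding_def e'_def k subset_iff image_subset_iff)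
  moreover have "finite (h ` Y)" "h ` X \<subseteq> h ` Y"
    using Y by auto
  ultimately have "\<exists>g. isometric_embedding (h ` Y) e' U d g \<and> (\<forall>x\<in>h ` X. g x = (f \<circ> k) x)"
    using U[unfolded S_Urysohn_space_def, THEN conjunct2, THEN conjunct2,
        rule_format, of "h ` Y" e' "h ` X" "f \<circ> k"] by simp
  then obtain g where g: "isometric_embedding (h ` Y) e' U d g"
      "\<forall>x\<in>h ` X. g x = (f \<circ> k) x"
    by blast
  show thesis
  proof
    show "isometric_embedding Y e U d (g \<circ> h)"
      using g(1) by (auto simp: isometric_embedding_def e'_def k)
    show "(g \<circ> h) x = f x" if "x \<in> X" for x
      using g(2) that \<open>X \<subseteq> Y\<close> by (auto simp: k subset_iff)
  qed
qed


section \<open>Isometry groups and homogeneous actions\<close>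

definition Iso_group :: "'a set \<Rightarrow> ('a \<Rightarrow> 'a \<Rightarrow> real) \<Rightarrow> ('a \<Rightarrow> 'a) monoid" where
  "Iso_group U d = (BijGroup U)\<lparr>carrier := {f \<in> Bij U. isometric_embedding U d U d f}\<rparr>"

definition acts_by_isometries ::
    "('g, 'm) monoid_scheme \<Rightarrow> 'a set \<Rightarrow> ('a \<Rightarrow> 'a \<Rightarrow> real) \<Rightarrow> ('g \<Rightarrow> 'a \<Rightarrow> 'a) \<Rightarrow> bool" where
  "acts_by_isometries G U d \<phi> \<longleftrightarrow>
     group_action G U \<phi> \<and> (\<forall>g\<in>carrier G. isometric_embedding U d U d (\<phi> g))"

text \<open>
  An isometry between the finite subsets \<open>A\<close> and \<open>p ` A\<close> is a distance-preserving map \<open>p\<close>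
  on \<open>A\<close>.
\<close>

definition homogeneous_action ::
    "('g, 'm) monoid_scheme \<Rightarrow> 'a set \<Rightarrow> ('a \<Rightarrow> 'a \<Rightarrow> real) \<Rightarrow> ('g \<Rightarrow> 'a \<Rightarrow> 'a) \<Rightarrow> bool" where
  "homogeneous_action G U d \<phi> \<longleftrightarrow> acts_by_isometries G U d \<phi> \<and>
     (\<forall>A p. finite A \<and> A \<subseteq> U \<and> isometric_embedding A d U d p \<longrightarrow>
        (\<exists>g\<in>carrier G. \<forall>x\<in>A. \<phi> g x = p x))"

definition in_class_H ::
    "('g, 'm) monoid_scheme \<Rightarrow> 'a set \<Rightarrow> ('a \<Rightarrow> 'a \<Rightarrow> real) \<Rightarrow> bool" where
  "in_class_H G U d \<longleftrightarrow> group G \<and> countable (carrier G) \<and>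
     (\<exists>\<phi>. faithful_action G U \<phi> \<and> homogeneous_action G U d \<phi>)"


section \<open>Permutations of the natural numbers\<close>

abbreviation Sym_nat :: "(nat \<Rightarrow> nat) monoid" where
  "Sym_nat \<equiv> BijGroup UNIV"

definition FinSym_nat :: "(nat \<Rightarrow> nat) monoid" where
  "FinSym_nat = Sym_nat\<lparr>carrier := {f \<in> Bij UNIV. finite {n. f n \<noteq> n}}\<rparr>"

lemma group_FinSym_nat: "group FinSym_nat"
proof -
  interpret S: group Sym_nat
    by (rule group_BijGroup)
  have "subgroup {f \<in> Bij UNIV. finite {n. f n \<noteq> n}} Sym_nat"
  proof
    show "{f \<in> Bij UNIV. finite {n. f n \<noteq> n}} \<subseteq> carrier Sym_nat"
      by (auto simp: BijGroup_def)
    show "\<one>\<^bsub>Sym_nat\<^esub> \<in> {f \<in> Bij UNIV. finite {n. f n \<noteq> n}}"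
      using id_Bij[of "UNIV :: nat set"] by (simp add: BijGroup_def)
  next
    fix f g :: "nat \<Rightarrow> nat"
    assume fg: "f \<in> {f \<in> Bij UNIV. finite {n. f n \<noteq> n}}"
      "g \<in> {f \<in> Bij UNIV. finite {n. f n \<noteq> n}}"
    then have "finite {n. f n \<noteq> n}" "finite {n. g n \<noteq> n}"
      by auto
    moreover have "{n. f (g n) \<noteq> n} \<subseteq> {n. f n \<noteq> n} \<union> {n. g n \<noteq> n}"
      by auto
    ultimately have "finite {n. f (g n) \<noteq> n}"
      by (meson finite_UnI finite_subset)
    with fg show "f \<otimes>\<^bsub>Sym_nat\<^esub> g \<in> {f \<in> Bij UNIV. finite {n. f n \<noteq> n}}"
      using compose_Bij[of f UNIV g] by (simp add: BijGroup_def compose_def)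
  next
    fix f :: "nat \<Rightarrow> nat"
    assume f: "f \<in> {f \<in> Bij UNIV. finite {n. f n \<noteq> n}}"
    then have "bij f"
      by (simp add: Bij_def)
    then have "{n. inv_into UNIV f n \<noteq> n} = {n. f n \<noteq> n}"
      using bij_inv_eq_iff[OF \<open>bij f\<close>] by (auto dest: sym)
    with f show "inv\<^bsub>Sym_nat\<^esub> f \<in> {f \<in> Bij UNIV. finite {n. f n \<noteq> n}}"
      using restrict_inv_into_Bij[of f UNIV] by (simp add: inv_BijGroup)
  qed
  then show ?thesis
    unfolding FinSym_nat_def by (rule S.subgroup_imp_group)
qed

end

theory Submission
  imports Defs
begin

text \<open>
  A product of two transpositions has order at most 3, so a transposition \<open>t\<close> satisfies
  \<open>(t g\<inverse> t g)\<^sup>6 = 1\<close> for every finitely supported permutation \<open>g\<close>. If \<open>S\<close> contains two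
  nonzero distances, no nontrivial involution in a group acting homogeneously on the Urysohn space
  satisfies such an identity: a type over a finite set that avoids the set has a realization which
  is moved by the involution, and homogeneity then gives \<open>g\<close> and a point whose orbit under
  \<open>t g\<inverse> t g\<close> is as long as desired.
\<close>

section \<open>Truncated sums in distance sets\<close>

text \<open>This treats both kinds of distance set at once: \<open>M\<close> is the maximum of a
  bounded one and may be any element of an unbounded one. So \<open>M\<close> need not bound
  \<open>S\<close>.\<close>

definition truncation :: "real set \<Rightarrow> real \<Rightarrow> bool" where
  "truncation S M \<longleftrightarrow> M \<in> S \<and> (\<forall>s\<in>S. \<forall>t\<in>S. min (s + t) M \<in> S)"

lemma truncation_above:
  assumes "bounded_distance_set S \<or> unbounded_distance_set S" "finite A" "A \<subseteq> S"
  obtains M where "truncation S M" "\<And>a. a \<in> A \<Longrightarrow> a \<le> M"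
proof (cases "bounded_distance_set S")
  case True
  then obtain M where "M \<in> S" "\<forall>s\<in>S. s \<le> M" "\<forall>s\<in>S. \<forall>t\<in>S. min (s + t) M \<in> S"
    by (auto simp: bounded_distance_set_def)
  then show thesis
    using that[of M] assms(3) by (auto simp: truncation_def)
next
  case False
  then have S: "0 \<in> S" "\<And>s t. s \<in> S \<Longrightarrow> t \<in> S \<Longrightarrow> s + t \<in> S"
    using assms(1) by (auto simp: unbounded_distance_set_def distance_values_def)
  define M where "M = Max (insert 0 A)"
  have "M \<in> S"
    using Max_in[of "insert 0 A"] assms(2,3) S(1) by (auto simp: M_def)
  then have "truncation S M"
    using S(2) by (auto simp: truncation_def min_def)
  then show thesis
    using that assms(2) by (auto simp: M_def)
qed

text \<open>Below \<open>M\<close> truncated sums are ordinary sums, so the multiples of the least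
  element of \<open>A\<close> and \<open>M\<close> stay in \<open>S\<close> until they reach
  \<open>M\<close>, and the last one before that is close to \<open>M\<close>. Such an
  \<open>s\<close> can replace \<open>M\<close> as a prescribed distance without breaking triangle
  inequalities.\<close>

lemma truncation_approx:
  assumes "truncation S M" "\<sigma> \<in> S" "0 < \<sigma>" "\<sigma> < M" "finite A" "A \<subseteq> S" "\<And>a. a \<in> A \<Longrightarrow> 0 < a"
  obtains s where "s \<in> S" "\<sigma> \<le> s" "s < M" "\<And>a. a \<in> A \<Longrightarrow> M \<le> s + a"
proof -
  define \<epsilon> where "\<epsilon> = Min (insert M A)"
  have "\<epsilon> \<in> insert M A"
    unfolding \<epsilon>_def using assms(5) by (intro Min_in) auto
  then have \<epsilon>: "\<epsilon> \<in> S" "0 < \<epsilon>"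
    using assms by (auto simp: truncation_def)
  have \<epsilon>_le: "\<epsilon> \<le> a" if "a \<in> A" for a
    using that assms(5) by (auto simp: \<epsilon>_def)
  have mult: "real (Suc k) * \<epsilon> \<in> S" if "real (Suc k) * \<epsilon> < M" for k
    using that
  proof (induction k)
    case 0
    then show ?case using \<epsilon> by simp
  next
    case (Suc k)
    then have "real (Suc k) * \<epsilon> \<in> S"
      using \<epsilon> by (simp add: distrib_right)
    then have "min (real (Suc k) * \<epsilon> + \<epsilon>) M \<in> S"
      using assms(1) \<epsilon> by (auto simp: truncation_def)
    with Suc.prems show ?case
      by (simp add: min_def distrib_right algebra_simps split: if_splits)
  qed
  obtain n where n: "M \<le> real (Suc n) * \<epsilon>" "\<And>k. k < n \<Longrightarrow> real (Suc k) * \<epsilon> < M"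
  proof -
    obtain m where "M < real m * \<epsilon>"
      using reals_Archimedean3[OF \<epsilon>(2)] by blast
    then have "M \<le> real (Suc m) * \<epsilon>"
      using \<epsilon> by (simp add: distrib_right)
    then show thesis
      using that[of "LEAST n. M \<le> real (Suc n) * \<epsilon>"]
      by (metis (mono_tags, lifting) LeastI not_less_Least not_le)
  qed
  \<comment> \<open>The maximum ensures \<open>\<sigma> \<le> s\<close> and supplies an element of
    \<open>S\<close> when \<open>n = 0\<close>.\<close>
  define s where "s = max \<sigma> (real n * \<epsilon>)"
  have "real n * \<epsilon> < M \<and> (n \<noteq> 0 \<longrightarrow> real n * \<epsilon> \<in> S)"
    using n(2)[of "n - 1"] mult[of "n - 1"] assms(3,4) by (cases n) auto
  then have "s \<in> S" "s < M"
    using assms(2-4) by (auto simp: s_def max_def)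
  moreover have "M \<le> s + a" if "a \<in> A" for a
    using n(1) \<epsilon>_le[OF that] by (simp add: s_def distrib_right)
  ultimately show thesis
    using that by (simp add: s_def)
qed


section \<open>One-point extensions\<close>

text \<open>Adjoining to \<open>E\<close> one point at the distances \<open>h\<close>, a positive
  Katetov function, gives a finite \<open>S\<close>-metric space. The extension property, applied to
  the inclusion of \<open>E\<close>, realizes that point in \<open>U\<close>.\<close>

lemma one_point_extension:
  assumes U: "S_Urysohn_space S U d" and "0 \<in> S"
    and E: "finite E" "E \<subseteq> U"
    and h: "\<And>x. x \<in> E \<Longrightarrow> h x \<in> S" "\<And>x. x \<in> E \<Longrightarrow> 0 < h x"
      "\<And>x y. x \<in> E \<Longrightarrow> y \<in> E \<Longrightarrow> x \<noteq> y \<Longrightarrow> h x \<le> h y + d x y"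
      "\<And>x y. x \<in> E \<Longrightarrow> y \<in> E \<Longrightarrow> x \<noteq> y \<Longrightarrow> d x y \<le> h x + h y"
  obtains z where "z \<in> U" "\<And>x. x \<in> E \<Longrightarrow> d z x = h x"
proof -
  have "Metric_space U d" and dS: "\<And>x y. x \<in> U \<Longrightarrow> y \<in> U \<Longrightarrow> d x y \<in> S"
    using U by (auto simp: S_Urysohn_space_def S_metric_space_def)
  then interpret Metric_space U d by simp
  have h3: "h x \<le> d x y + h y" "h x \<le> h y + d y x" if "x \<in> E" "y \<in> E" for x y
    using h(3)[OF that] commute[of y x] by (cases "x = y"; simp)+
  have h4: "d x y \<le> h x + h y" if "x \<in> E" "y \<in> E" for x y
    using h(4)[OF that] h(2)[OF that(1)] that E by (cases "x = y") auto
  have h_abs: "\<bar>h x\<bar> = h x" "h x \<noteq> 0" if "x \<in> E" for x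
    using h(2)[OF that] by auto
  define e where "e u v = (case u of
      None \<Rightarrow> (case v of None \<Rightarrow> 0 | Some y \<Rightarrow> \<bar>h y\<bar>)
    | Some x \<Rightarrow> (case v of None \<Rightarrow> \<bar>h x\<bar> | Some y \<Rightarrow> d x y))" for u v
  define Y where "Y = insert None (Some ` E)"
  have d0: "d x y = 0 \<longleftrightarrow> x = y" if "x \<in> E" "y \<in> E" for x y
    using zero that E by blast
  have tri: "d x z \<le> d x y + d y z" if "x \<in> E" "y \<in> E" "z \<in> E" for x y z
    using triangle that E by blast
  have "Metric_space Y e"
  proof
    show "0 \<le> e u v" for u v
      by (auto simp: e_def split: option.splits)
    show "e u v = e v u" for u v
      by (auto simp: e_def commute split: option.splits)
    show "e u v = 0 \<longleftrightarrow> u = v" if "u \<in> Y" "v \<in> Y" for u v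
      using that by (auto simp: e_def Y_def h_abs d0)
    show "e u w \<le> e u v + e v w" if "u \<in> Y" "v \<in> Y" "w \<in> Y" for u v w
      using that by (auto simp: e_def Y_def h_abs intro: tri h3 h4 less_imp_le[OF h(2)])
  qed
  then have "S_metric_space S Y e"
    using E h(1) less_imp_le[OF h(2)] dS \<open>0 \<in> S\<close>
    by (auto simp: S_metric_space_def Y_def e_def subset_iff)
  moreover have "isometric_embedding (Some ` E) e U d the"
    using E by (auto simp: isometric_embedding_def e_def)
  moreover have "finite Y" "Some ` E \<subseteq> Y"
    using E by (auto simp: Y_def)
  ultimately obtain g where g: "isometric_embedding Y e U d g" "\<And>x. x \<in> Some ` E \<Longrightarrow> g x = the x"
    using S_Urysohn_extension[OF U] by metis
  show thesis
  proof
    show "g None \<in> U"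
      using g(1) by (auto simp: isometric_embedding_def Y_def)
    show "d (g None) x = h x" if "x \<in> E" for x
    proof -
      have "d (g None) (g (Some x)) = e None (Some x)"
        using g(1) that by (auto simp: isometric_embedding_def Y_def)
      then show ?thesis
        using g(2)[of "Some x"] h(2)[OF that] that by (simp add: e_def)
    qed
  qed
qed


section \<open>Points moved by an involution\<close>

locale Urysohn_involution =
  fixes S :: "real set" and U :: "'a set" and d :: "'a \<Rightarrow> 'a \<Rightarrow> real" and T :: "'a \<Rightarrow> 'a"
  assumes distance_set: "bounded_distance_set S \<or> unbounded_distance_set S"
    and two_distances: "\<exists>s\<in>S. \<exists>t\<in>S. 0 < s \<and> s < t"
    and Urysohn: "S_Urysohn_space S U d"
    and closed: "x \<in> U \<Longrightarrow> T x \<in> U"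
    and involution: "x \<in> U \<Longrightarrow> T (T x) = x"
    and isometry: "x \<in> U \<Longrightarrow> y \<in> U \<Longrightarrow> d (T x) (T y) = d x y"
    and nontrivial: "\<exists>a\<in>U. T a \<noteq> a"
begin

sublocale Metric_space U d
  using Urysohn by (simp add: S_Urysohn_space_def S_metric_space_def)

lemma dist_in: "x \<in> U \<Longrightarrow> y \<in> U \<Longrightarrow> d x y \<in> S"
  using Urysohn by (simp add: S_Urysohn_space_def S_metric_space_def)

lemma zero_in: "0 \<in> S"
  using distance_set
  by (auto simp: bounded_distance_set_def unbounded_distance_set_def distance_values_def)

lemma dist_pos: "x \<in> U \<Longrightarrow> y \<in> U \<Longrightarrow> x \<noteq> y \<Longrightarrow> 0 < d x y"
  using zero[of x y] nonneg[of x y] by linarith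

text \<open>A fixed \<open>z\<close> would be equidistant from \<open>a\<close> and
  \<open>T a\<close>. All moved points constructed below are recognized in this way.\<close>

lemma moved_if_dist_neq:
  assumes "z \<in> U" "a \<in> U" "d z a \<noteq> d z (T a)"
  shows "T z \<noteq> z"
  using isometry[OF assms(1,2)] assms(3) by metis

lemma truncation_above_dists:
  assumes "finite E" "E \<subseteq> U"
  obtains M \<sigma> where "truncation S M" "\<sigma> \<in> S" "0 < \<sigma>" "\<sigma> < M"
    "\<And>x y. x \<in> E \<Longrightarrow> y \<in> E \<Longrightarrow> d x y \<le> M"
proof -
  obtain s t where st: "s \<in> S" "t \<in> S" "0 < s" "s < t"
    using two_distances by auto
  \<comment> \<open>Including \<open>t\<close> forces \<open>t \<le> M\<close>, so that
    \<open>s\<close> can serve as \<open>\<sigma>\<close>.\<close>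
  obtain M where M: "truncation S M"
      "\<And>r. r \<in> insert t ((\<lambda>(x, y). d x y) ` (E \<times> E)) \<Longrightarrow> r \<le> M"
  proof (rule truncation_above[OF distance_set])
    show "finite (insert t ((\<lambda>(x, y). d x y) ` (E \<times> E)))"
      using assms by simp
    show "insert t ((\<lambda>(x, y). d x y) ` (E \<times> E)) \<subseteq> S"
      using assms st dist_in by auto
  qed blast
  have "d x y \<le> M" if "x \<in> E" "y \<in> E" for x y
    using M(2)[of "d x y"] that by force
  moreover have "t \<le> M"
    using M(2) by simp
  ultimately show thesis
    using that[of M s] M(1) st by auto
qed

text \<open>From one moved \<open>a\<close> a new point is built at distance
  \<open>\<alpha> < M\<close> from \<open>a\<close> and \<open>M\<close> from \<open>T a\<close>,
  hence moved. Its distances to \<open>E\<close> are positive, which keeps it outside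
  \<open>E\<close>.\<close>

lemma moved_outside:
  assumes "finite E" "E \<subseteq> U"
  obtains a where "a \<in> U" "T a \<noteq> a" "a \<notin> E"
proof -
  obtain a where a: "a \<in> U" "T a \<noteq> a"
    using nontrivial by auto
  define E' where "E' = insert a (insert (T a) E)"
  have E': "finite E'" "E' \<subseteq> U"
    using assms a closed by (auto simp: E'_def)
  obtain M \<sigma> where M: "truncation S M" and \<sigma>: "\<sigma> \<in> S" "0 < \<sigma>" "\<sigma> < M"
    and d_le: "\<And>x y. x \<in> E' \<Longrightarrow> y \<in> E' \<Longrightarrow> d x y \<le> M"
    using truncation_above_dists[OF E'] by metis
  have "0 < d a (T a)" "d a (T a) \<in> S"
    using a closed by (auto intro: dist_pos dist_in)
  then obtain \<alpha> where \<alpha>: "\<alpha> \<in> S" "\<sigma> \<le> \<alpha>" "\<alpha> < M" "M \<le> \<alpha> + d a (T a)"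
    using truncation_approx[OF M \<sigma>, of "{d a (T a)}"] by auto
  \<comment> \<open>The length of the path through \<open>a\<close>, cut off at \<open>M\<close>;
    the choice of \<open>\<alpha>\<close> makes the value at \<open>T a\<close> equal to
    \<open>M\<close>.\<close>
  define h where "h x = min (d x a + \<alpha>) M" for x
  obtain z where z: "z \<in> U" "\<And>x. x \<in> E' \<Longrightarrow> d z x = h x"
  proof (rule one_point_extension[OF Urysohn zero_in E', of h])
    show "h x \<in> S" if "x \<in> E'" for x
      using M \<alpha>(1) dist_in[of x a] that E' a by (auto simp: h_def truncation_def)
    show "0 < h x" if "x \<in> E'" for x
      using \<sigma> \<alpha> nonneg[of x a] unfolding h_def by linarith
    fix x y assume xy: "x \<in> E'" "y \<in> E'"
    then have "d x a \<le> d x y + d y a"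
      using triangle E' a by blast
    then show "h x \<le> h y + d x y"
      using nonneg[of x y] unfolding h_def by linarith
    have "d x y \<le> d x a + d y a"
      using triangle[of x a y] commute[of a y] xy E' a by auto
    then show "d x y \<le> h x + h y"
      using d_le[OF xy] \<sigma> \<alpha> nonneg[of x a] nonneg[of y a] unfolding h_def by linarith
  qed blast
  have "d z a = \<alpha>" "d z (T a) = M"
    using z(2)[of a] z(2)[of "T a"] \<alpha> commute[of a "T a"] a by (auto simp: h_def E'_def)
  then have "T z \<noteq> z"
    using moved_if_dist_neq[of z a] z a \<alpha> by simp
  moreover have "z \<notin> E"
  proof
    assume "z \<in> E"
    then have "h z = 0"
      using z by (force simp: E'_def)
    then show False
      using \<sigma> \<alpha> nonneg[of z a] unfolding h_def by linarith
  qed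
  ultimately show thesis
    using that z(1) by blast
qed

text \<open>
  The distances to \<open>F\<close> are those of \<open>z\<close>; unequal distances to some \<open>b\<close> and \<open>T b\<close> then force
  the new point to be moved. To leave room for this, \<open>b\<close> and \<open>T b\<close> are taken at
  the maximal distance \<open>M\<close> from \<open>F\<close>.
\<close>

lemma moved_realization:
  assumes F: "finite F" "F \<subseteq> U" and z: "z \<in> U" "z \<notin> F"
  obtains q where "q \<in> U" "T q \<noteq> q" "\<And>x. x \<in> F \<Longrightarrow> d q x = d z x"
proof -
  \<comment> \<open>The distances from \<open>T b\<close> to \<open>F\<close> are those from
    \<open>b\<close> to the image of \<open>F\<close> under \<open>T\<close>, so \<open>b\<close>
    has to be controlled on that image as well.\<close>
  define G where "G = F \<union> T ` F"
  have G: "finite G" "G \<subseteq> U"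
    using F closed by (auto simp: G_def)
  obtain a where a: "a \<in> U" "T a \<noteq> a" "a \<notin> G"
    using moved_outside[OF G] by metis
  define E where "E = insert a (insert (T a) G)"
  have E: "finite E" "E \<subseteq> U"
    using G a closed by (auto simp: E_def)
  then obtain M \<sigma> where M: "truncation S M" and \<sigma>: "\<sigma> \<in> S" "0 < \<sigma>" "\<sigma> < M"
    and d_le: "\<And>x y. x \<in> insert z E \<Longrightarrow> y \<in> insert z E \<Longrightarrow> d x y \<le> M"
    using truncation_above_dists[of "insert z E"] z by auto
  have "M \<in> S"
    using M by (simp add: truncation_def)
  \<comment> \<open>\<open>\<alpha>\<close> is so close to \<open>M\<close> that the values
    \<open>\<alpha>\<close> at \<open>a\<close> and \<open>M\<close> on the rest of \<open>E\<close>
    form a Katetov function; \<open>\<alpha> < M\<close> will make \<open>b\<close> moved.\<close>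
  obtain \<alpha> where \<alpha>: "\<alpha> \<in> S" "\<sigma> \<le> \<alpha>" "\<alpha> < M" "\<And>r. r \<in> d a ` (E - {a}) \<Longrightarrow> M \<le> \<alpha> + r"
  proof (rule truncation_approx[OF M \<sigma>, of "d a ` (E - {a})"])
    show "finite (d a ` (E - {a}))" "d a ` (E - {a}) \<subseteq> S"
      using E a dist_in by auto
    show "0 < r" if "r \<in> d a ` (E - {a})" for r
      using that E a dist_pos by auto
  qed blast
  have \<alpha>_a: "M \<le> \<alpha> + d a x" "M \<le> \<alpha> + d x a" if "x \<in> E" "x \<noteq> a" for x
    using \<alpha>(4)[OF imageI, of x] that commute[of a x] by auto
  obtain b where b: "b \<in> U" "\<And>x. x \<in> E \<Longrightarrow> d b x = (if x = a then \<alpha> else M)"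
  proof (rule one_point_extension[OF Urysohn zero_in E, of "\<lambda>x. if x = a then \<alpha> else M"])
    fix x y assume xy: "x \<in> E" "y \<in> E" "x \<noteq> y"
    then show "(if x = a then \<alpha> else M) \<le> (if y = a then \<alpha> else M) + d x y"
      using \<alpha>_a[of x] \<alpha>_a[of y] \<alpha>(3) nonneg[of x y] by (auto intro: add_increasing2)
    show "d x y \<le> (if x = a then \<alpha> else M) + (if y = a then \<alpha> else M)"
      using d_le[of x y] xy \<sigma> \<alpha> by auto
  next
    show "(if x = a then \<alpha> else M) \<in> S" "0 < (if x = a then \<alpha> else M)" for x
      using \<alpha> \<sigma> \<open>M \<in> S\<close> by auto
  qed blast
  have b_a: "d b a = \<alpha>" "d b (T a) = M"
    using b(2)[of a] b(2)[of "T a"] a by (auto simp: E_def)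
  then have "T b \<noteq> b"
    using moved_if_dist_neq[of b a] a b \<alpha> by simp
  have Tb: "T b \<in> U"
    using b closed by simp
  have "d b (T b) \<le> d b (T a) + d (T a) (T b)"
    using triangle b(1) a(1) closed by simp
  \<comment> \<open>\<open>b\<close> is chosen after \<open>M\<close>, so \<open>M\<close> need not
    bound this distance. The bound \<open>M + \<alpha>\<close> suffices because \<open>h\<close>
    takes the values \<open>M\<close> and \<open>s \<ge> \<alpha>\<close> at \<open>b\<close> and
    \<open>T b\<close>.\<close>
  then have Tb_le: "d b (T b) \<le> M + \<alpha>"
    using b_a isometry[of a b] commute[of a b] a b by simp
  have bF: "d b x = M" "d x b = M" if "x \<in> F" for x
    using b(2)[of x] that a(3) commute[of x b] by (auto simp: E_def G_def)
  have TbF: "d (T b) x = M" "d x (T b) = M" if "x \<in> F" for x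
  proof -
    have "x \<in> U" "T x \<in> G"
      using that F by (auto simp: G_def)
    then have "d (T b) x = d b (T x)"
      using isometry[of b "T x"] b involution closed by simp
    also have "\<dots> = M"
      using b(2)[of "T x"] \<open>T x \<in> G\<close> a(3) by (auto simp: E_def)
    finally show "d (T b) x = M" "d x (T b) = M"
      using commute[of x "T b"] by auto
  qed
  have "b \<notin> F" "T b \<notin> F"
    using bF[of b] TbF[of "T b"] b Tb \<sigma> by auto
  define A where "A = insert (d b (T b)) (d z ` F)"
  \<comment> \<open>The element \<open>d b (T b)\<close> of \<open>A\<close> makes the values
    \<open>M\<close> at \<open>b\<close> and \<open>s\<close> at \<open>T b\<close> compatible; the
    others make \<open>s\<close> compatible with the distances from \<open>z\<close> on
    \<open>F\<close>.\<close>
  obtain s where s: "s \<in> S" "\<alpha> \<le> s" "s < M" "\<And>r. r \<in> A \<Longrightarrow> M \<le> s + r"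
  proof (rule truncation_approx[OF M, of \<alpha> A])
    show "\<alpha> \<in> S" "0 < \<alpha>" "\<alpha> < M"
      using \<alpha> \<sigma> by auto
    show "finite A" "A \<subseteq> S"
      using F z b Tb dist_in by (auto simp: A_def)
    show "0 < r" if "r \<in> A" for r
      using that F z b Tb \<open>T b \<noteq> b\<close> dist_pos by (auto simp: A_def)
  qed blast
  have sA: "M \<le> s + d b (T b)" "M \<le> s + d (T b) b" "\<And>x. x \<in> F \<Longrightarrow> M \<le> s + d z x"
    using s(4) commute[of b "T b"] by (auto simp: A_def)
  have zF: "d z x \<le> M" if "x \<in> F" for x
    using d_le[of z x] that by (auto simp: E_def G_def)
  have tri: "d z x \<le> d z y + d x y" "d x y \<le> d z x + d z y" if "x \<in> F" "y \<in> F" for x y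
    using triangle[of z y x] triangle[of x z y] commute[of y x] commute[of x z] that F z by auto
  define h where "h x = (if x = b then M else if x = T b then s else d z x)" for x
  have h: "h b = M" "h (T b) = s" "\<And>x. x \<in> F \<Longrightarrow> h x = d z x"
    using \<open>T b \<noteq> b\<close> \<open>b \<notin> F\<close> \<open>T b \<notin> F\<close> by (auto simp: h_def)
  define E2 where "E2 = insert b (insert (T b) F)"
  have E2: "finite E2" "E2 \<subseteq> U"
    using F b Tb by (auto simp: E2_def)
  obtain q where q: "q \<in> U" "\<And>x. x \<in> E2 \<Longrightarrow> d q x = h x"
  proof (rule one_point_extension[OF Urysohn zero_in E2, of h])
    show "h x \<in> S" if "x \<in> E2" for x
      using that h \<open>M \<in> S\<close> s(1) dist_in[OF z(1), of x] F by (auto simp: E2_def)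
    show "0 < h x" if "x \<in> E2" for x
      using that h \<sigma> \<alpha>(2,3) s dist_pos[OF z(1), of x] F z by (auto simp: E2_def)
    fix x y assume "x \<in> E2" "y \<in> E2" "x \<noteq> y"
    then consider "x \<in> F" "y \<in> F" | "x = b" "y = T b" | "x = T b" "y = b"
      | "x = b" "y \<in> F" | "x = T b" "y \<in> F" | "x \<in> F" "y = b" | "x \<in> F" "y = T b"
      by (auto simp: E2_def)
    then show "h x \<le> h y + d x y"
    proof cases
      case 1 then show ?thesis using tri h by auto
    next
      case 2 then show ?thesis using h sA by simp
    next
      case 3 then show ?thesis using h s by (auto intro: add_increasing2)
    next
      case 4 then show ?thesis using h bF nonneg[of z y] by simp
    next
      case 5 then show ?thesis using h s TbF by (auto intro: add_increasing)
    next
      case 6 then show ?thesis using h zF[of x] bF \<alpha> \<sigma> by simp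
    next
      case 7 then show ?thesis using h zF[of x] TbF s \<alpha> \<sigma> by simp
    qed
    from \<open>x \<in> E2\<close> \<open>y \<in> E2\<close> \<open>x \<noteq> y\<close>
    consider "x \<in> F" "y \<in> F" | "x = b" "y = T b" | "x = T b" "y = b"
      | "x = b" "y \<in> F" | "x = T b" "y \<in> F" | "x \<in> F" "y = b" | "x \<in> F" "y = T b"
      by (auto simp: E2_def)
    then show "d x y \<le> h x + h y"
    proof cases
      case 1 then show ?thesis using tri h by auto
    next
      case 2 then show ?thesis using h Tb_le s by simp
    next
      case 3 then show ?thesis using h Tb_le s commute[of b "T b"] by simp
    next
      case 4 then show ?thesis using h bF nonneg[of z y] by simp
    next
      case 5 then show ?thesis using h sA TbF by simp
    next
      case 6 then show ?thesis using h bF nonneg[of z x] by simp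
    next
      case 7 then show ?thesis using h sA(3)[of x] TbF by simp
    qed
  qed blast
  have "d q b = M" "d q (T b) = s"
    using q(2) h by (auto simp: E2_def)
  then have "T q \<noteq> q"
    using moved_if_dist_neq[of q b] q b s by simp
  moreover have "d q x = d z x" if "x \<in> F" for x
    using that q(2) h by (auto simp: E2_def)
  ultimately show thesis
    using that q(1) by blast
qed

text \<open>If \<open>z \<noteq> v\<close>, adding \<open>v\<close> to \<open>F\<close> keeps
  \<open>q\<close> at positive distance from \<open>v\<close>. If \<open>z = v\<close>, a twin
  \<open>w\<close> of \<open>v\<close> with the same distances to \<open>F\<close> is constructed
  first and takes the place of \<open>z\<close>.\<close>

lemma moved_realization_avoiding:
  assumes F: "finite F" "F \<subseteq> U" "F \<noteq> {}" and z: "z \<in> U" "z \<notin> F" and v: "v \<in> U"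
  obtains q where "q \<in> U" "q \<noteq> v" "T q \<noteq> q" "\<And>x. x \<in> F \<Longrightarrow> d q x = d z x"
proof -
  obtain w where w: "w \<in> U" "w \<noteq> v" "w \<notin> F" "\<And>x. x \<in> F \<Longrightarrow> d w x = d z x"
  proof (cases "z = v")
    case False
    then show thesis using that[of z] z by simp
  next
    case True
    \<comment> \<open>\<open>r\<close> will be the distance from \<open>v\<close> to its twin. Any
      positive element of \<open>S\<close> up to twice the least distance from \<open>v\<close> to
      \<open>F\<close> would be consistent.\<close>
    define r where "r = Min (d v ` F)"
    have r_le: "r \<le> d v x" if "x \<in> F" for x
      using that F by (auto simp: r_def)
    have "r \<in> d v ` F"
      unfolding r_def using F by (intro Min_in) auto
    then have r: "r \<in> S" "0 < r"
      using dist_in dist_pos F v z True by auto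
    have tri: "d v x \<le> d v y + d x y" "d x y \<le> d v x + d v y" if "x \<in> F" "y \<in> F" for x y
      using triangle[of v y x] triangle[of x v y] commute[of y x] commute[of x v] that F v by auto
    have F': "finite (insert v F)" "insert v F \<subseteq> U"
      using F v by auto
    obtain w where w: "w \<in> U" "\<And>x. x \<in> insert v F \<Longrightarrow> d w x = (if x = v then r else d v x)"
    proof (rule one_point_extension[OF Urysohn zero_in F', of "\<lambda>x. if x = v then r else d v x"])
      show "(if x = v then r else d v x) \<in> S" if "x \<in> insert v F" for x
        using that r F v dist_in by auto
      show "0 < (if x = v then r else d v x)" if "x \<in> insert v F" for x
        using that r F v dist_pos[of v x] by auto
      fix x y assume xy: "x \<in> insert v F" "y \<in> insert v F" "x \<noteq> y"
      then show "(if x = v then r else d v x) \<le> (if y = v then r else d v y) + d x y"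
        using tri r r_le[of y] commute[of x v] nonneg[of v y] by auto
      show "d x y \<le> (if x = v then r else d v x) + (if y = v then r else d v y)"
        using xy tri r commute[of x v] by auto
    qed blast
    have "w \<noteq> v"
      using w(2)[of v] r w(1) by auto
    moreover have wF: "d w x = d z x" if "x \<in> F" for x
      using w(2)[of x] that z True by auto
    moreover have "w \<notin> F"
      using wF[of w] w(1) z by auto
    ultimately show thesis
      using that w(1) by blast
  qed
  obtain q where q: "q \<in> U" "T q \<noteq> q" "\<And>x. x \<in> insert v F \<Longrightarrow> d q x = d w x"
    using moved_realization[of "insert v F" w] F v w by auto
  have "q \<noteq> v"
    using q(3)[of v] q(1) w by auto
  then show thesis
    using that[of q] q w(4) by simp
qed

end

section \<open>Homogeneous actions\<close>

text \<open>The map that fixes \<open>F\<close> and sends \<open>z\<close> to \<open>q\<close> is a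
  partial isometry. Multiplying by the resulting element changes the effect of a group element at
  one point and keeps finitely many other values.\<close>

lemma homogeneous_replace_point:
  assumes "homogeneous_action G U d \<phi>" "Metric_space U d"
    and F: "finite F" "F \<subseteq> U" and zq: "z \<in> U" "q \<in> U" "z \<notin> F" "\<And>x. x \<in> F \<Longrightarrow> d q x = d z x"
  obtains g where "g \<in> carrier G" "\<phi> g z = q" "\<And>x. x \<in> F \<Longrightarrow> \<phi> g x = x"
proof -
  interpret Metric_space U d by fact
  define f where "f x = (if x = z then q else x)" for x
  have "d (f x) (f y) = d x y" if "x \<in> insert z F" "y \<in> insert z F" for x y
    using that zq zq(4)[of x] zq(4)[of y] commute[of x] by (auto simp: f_def)
  moreover have "f ` insert z F \<subseteq> U"
    using F zq by (auto simp: f_def)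
  ultimately have "isometric_embedding (insert z F) d U d f"
    by (auto simp: isometric_embedding_def)
  then obtain g where g: "g \<in> carrier G" "\<forall>x\<in>insert z F. \<phi> g x = f x"
    using assms(1) F zq(1) unfolding homogeneous_action_def
    by (metis finite_insert insert_subset)
  show thesis
    using that[of g] g zq(3) by (metis f_def insertCI)
qed

text \<open>
  The conjugate of \<open>T\<close> by \<open>\<phi> g\<close> exchanges \<open>p (2 * i)\<close> and \<open>p (2 * i + 1)\<close>, so its product with
  \<open>T\<close> moves \<open>p 0\<close> along the even points of the path. Given a path of length \<open>2 * n\<close>, the element
  \<open>g\<close> is changed so that \<open>\<phi> g (p (2 * n))\<close> becomes a point moved by \<open>T\<close>, and then
  \<open>p (2 * n + 1)\<close> is chosen to be moved by \<open>T\<close> as well.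
\<close>

lemma (in Urysohn_involution) alternating_path:
  fixes n :: nat
  assumes hom: "homogeneous_action G U d \<phi>"
  shows "\<exists>g\<in>carrier G. \<exists>p. p ` {..2 * n} \<subseteq> U \<and> inj_on p {..2 * n} \<and>
    (\<forall>i<n. T (\<phi> g (p (2 * i))) = \<phi> g (p (2 * i + 1)) \<and> T (p (2 * i + 1)) = p (2 * i + 2))"
proof (induction n)
  interpret group_action G U \<phi>
    using hom by (simp add: homogeneous_action_def acts_by_isometries_def)
  interpret G: group G
    using group_hom by (simp add: group_hom_def)
  case 0
  obtain a where "a \<in> U"
    using nontrivial by auto
  then show ?case
    by (intro bexI[of _ "\<one>\<^bsub>G\<^esub>"] exI[of _ "\<lambda>_. a"]) auto
next
  interpret group_action G U \<phi>
    using hom by (simp add: homogeneous_action_def acts_by_isometries_def)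
  interpret G: group G
    using group_hom by (simp add: group_hom_def)
  have act: "\<phi> g x \<in> U" if "g \<in> carrier G" "x \<in> U" for g x
    using element_image that by blast
  have act_inj: "\<phi> g x = \<phi> g y \<longleftrightarrow> x = y" if "g \<in> carrier G" "x \<in> U" "y \<in> U" for g x y
    using inj_prop[OF that(1)] that by (auto simp: inj_on_def)
  case (Suc n)
  then obtain g p where g: "g \<in> carrier G" and pU: "p ` {..2 * n} \<subseteq> U" and p_inj: "inj_on p {..2 * n}"
    and Tg: "\<And>i. i < n \<Longrightarrow> T (\<phi> g (p (2 * i))) = \<phi> g (p (2 * i + 1))"
    and Tp: "\<And>i. i < n \<Longrightarrow> T (p (2 * i + 1)) = p (2 * i + 2)"
    by blast
  have pj: "p j \<in> U" if "j \<le> 2 * n" for j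
    using pU that by auto
  \<comment> \<open>The images of the points already paired by the conjugate of \<open>T\<close>;
    \<open>z\<close> is the image of the end of the path, which has no partner yet.\<close>
  define F where "F = (\<lambda>j. \<phi> g (p j)) ` {..<2 * n}"
  define z where "z = \<phi> g (p (2 * n))"
  have F: "finite F" "F \<subseteq> U"
    using g pj act by (auto simp: F_def)
  have z: "z \<in> U"
    using g pj act by (auto simp: z_def)
  have "p (2 * n) \<noteq> p j" if "j < 2 * n" for j
    using that p_inj by (auto dest!: inj_onD)
  then have "z \<notin> F"
    using g pj by (auto simp: z_def F_def act_inj)
  have TF: "T x \<in> F" if x: "x \<in> F" for x
  proof -
    obtain j where j: "j < 2 * n" "x = \<phi> g (p j)"
      using x by (auto simp: F_def)
    show ?thesis
    proof (cases "even j")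
      case True
      then obtain i where "j = 2 * i" by blast
      then show ?thesis
        using Tg[of i] j by (auto simp: F_def)
    next
      case False
      then obtain i where "j = 2 * i + 1" using oddE by blast
      then have "x = T (\<phi> g (p (2 * i)))" "2 * i < 2 * n"
        using Tg[of i] j by auto
      then show ?thesis
        using involution[OF act[OF g pj]] by (auto simp: F_def)
    qed
  qed
  \<comment> \<open>\<open>T\<close> might fix \<open>z\<close>, so the group element is altered to
    send the end of the path to a moved \<open>q\<close>. Fixing \<open>F\<close> preserves the
    earlier relations.\<close>
  obtain q where q: "q \<in> U" "T q \<noteq> q" "\<And>x. x \<in> F \<Longrightarrow> d q x = d z x"
    using moved_realization[OF F z \<open>z \<notin> F\<close>] by metis
  have "q \<notin> F"
    using q(3)[of q] q(1) z \<open>z \<notin> F\<close> by auto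
  have "Metric_space U d" ..
  obtain k where k: "k \<in> carrier G" "\<phi> k z = q" "\<And>x. x \<in> F \<Longrightarrow> \<phi> k x = x"
    using homogeneous_replace_point[OF hom \<open>Metric_space U d\<close> F z q(1) \<open>z \<notin> F\<close> q(3)] by metis
  define g1 where "g1 = k \<otimes>\<^bsub>G\<^esub> g"
  have g1: "g1 \<in> carrier G" "\<phi> g1 (p (2 * n)) = q" "\<And>j. j < 2 * n \<Longrightarrow> \<phi> g1 (p j) = \<phi> g (p j)"
    using g k pj composition_rule by (auto simp: g1_def z_def F_def)
  \<comment> \<open>Under \<open>g1\<close> the next point has to be \<open>w\<close>; since
    \<open>T\<close> might fix it, it is replaced by \<open>v\<close> later.\<close>
  obtain w where w: "w \<in> U" "\<phi> g1 w = T q"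
    using bij_prop1[OF g1(1) closed[OF q(1)]] by auto
  define P where "P = p ` {..2 * n}"
  have P: "finite P" "P \<subseteq> U" "P \<noteq> {}"
    using pU by (auto simp: P_def)
  \<comment> \<open>\<open>T q\<close> differs from \<open>q\<close>, and it avoids \<open>F\<close>
    because \<open>F\<close> is stable under \<open>T\<close> and misses \<open>q\<close>.\<close>
  have "w \<notin> P"
  proof
    assume "w \<in> P"
    then obtain j where j: "j \<le> 2 * n" "w = p j"
      by (auto simp: P_def)
    show False
    proof (cases "j = 2 * n")
      case True
      then show False using w g1(2) q j by simp
    next
      case False
      then have "j < 2 * n" "T q = \<phi> g (p j)"
        using w g1(3)[of j] j by auto
      then have "T q \<in> F"
        by (simp add: F_def)
      then show False
        using TF[of "T q"] involution[OF q(1)] \<open>q \<notin> F\<close> by simp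
    qed
  qed
  have p0: "p 0 \<in> U"
    using pj by simp
  \<comment> \<open>\<open>p 0\<close> is the only path point that the relations do not pair under
    \<open>T\<close>. Avoiding \<open>T (p 0)\<close> therefore excludes the one case in which
    \<open>T v\<close> could fall back on the path.\<close>
  obtain v where v: "v \<in> U" "v \<noteq> T (p 0)" "T v \<noteq> v" "\<And>x. x \<in> P \<Longrightarrow> d v x = d w x"
    using moved_realization_avoiding[OF P w(1) \<open>w \<notin> P\<close> closed[OF p0]] by metis
  have "v \<notin> P"
    using v(4)[of v] v(1) w \<open>w \<notin> P\<close> by auto
  obtain l where l: "l \<in> carrier G" "\<phi> l v = w" "\<And>x. x \<in> P \<Longrightarrow> \<phi> l x = x"
    using homogeneous_replace_point[OF hom \<open>Metric_space U d\<close> P(1,2) v(1) w(1) \<open>v \<notin> P\<close>] v(4) by metis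
  define g2 where "g2 = g1 \<otimes>\<^bsub>G\<^esub> l"
  have g2: "g2 \<in> carrier G" "\<phi> g2 v = T q" "\<And>j. j \<le> 2 * n \<Longrightarrow> \<phi> g2 (p j) = \<phi> g1 (p j)"
    using g1 l w pj v composition_rule by (auto simp: g2_def P_def)
  have "T v \<notin> P"
  proof
    assume "T v \<in> P"
    then obtain j where j: "j \<le> 2 * n" "T v = p j"
      by (auto simp: P_def)
    then have vj: "v = T (p j)"
      using involution[OF v(1)] by simp
    have "j = 0 \<or> (\<exists>i. j = 2 * i + 1) \<or> (\<exists>i. j = 2 * i + 2)"
      by presburger
    then consider "j = 0" | i where "j = 2 * i + 1" | i where "j = 2 * i + 2"
      by blast
    then show False
    proof cases
      case 1
      then show False using vj v(2) by simp
    next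
      case 2
      then have "i < n"
        using j(1) by linarith
      then have "v = p (2 * i + 2)" "2 * i + 2 \<le> 2 * n"
        using Tp[of i] vj 2 by auto
      then show False using \<open>v \<notin> P\<close> by (auto simp: P_def)
    next
      case 3
      then have "p j = T (p (2 * i + 1))" "2 * i + 1 \<le> 2 * n"
        using Tp[of i] j(1) by auto
      then have "v = p (2 * i + 1)"
        using vj involution pj by simp
      then show False
        using \<open>v \<notin> P\<close> \<open>2 * i + 1 \<le> 2 * n\<close> by (auto simp: P_def)
    qed
  qed
  define p' where "p' = p(2 * n + 1 := v, 2 * n + 2 := T v)"
  have p': "p' j = p j" if "j \<le> 2 * n" for j
    using that by (simp add: p'_def)
  have p'_new: "p' (2 * n + 1) = v" "p' (2 * n + 2) = T v"
    by (auto simp: p'_def)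
  have atMost: "{..2 * Suc n} = insert (2 * n + 2) (insert (2 * n + 1) {..2 * n})"
    by auto
  have p'P: "p' ` {..2 * n} = P"
    using p' by (auto simp: P_def)
  have "p' ` {..2 * Suc n} \<subseteq> U"
    unfolding atMost image_insert p'P p'_new using P v closed by auto
  moreover have "inj_on p' {..2 * n}"
    using p_inj p' by (simp add: inj_on_def)
  then have "inj_on p' {..2 * Suc n}"
    unfolding atMost using \<open>v \<notin> P\<close> \<open>T v \<notin> P\<close> v(3) p'P p'_new by (simp add: image_insert)
  moreover have "T (\<phi> g2 (p' (2 * i))) = \<phi> g2 (p' (2 * i + 1)) \<and> T (p' (2 * i + 1)) = p' (2 * i + 2)"
    if "i < Suc n" for i
  proof (cases "i = n")
    case True
    then show ?thesis
      using p'_new p' g2 g1 by simp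
  next
    case False
    then show ?thesis
      using that Tg[of i] Tp[of i] p' g1 g2 by simp
  qed
  ultimately show ?case
    using g2(1) by blast
qed

text \<open>The word sends \<open>p (2 * i)\<close> to \<open>p (2 * i + 2)\<close> along an
  alternating path of length \<open>2 * n\<close>; as the path is injective, the \<open>n\<close>-th
  power moves \<open>p 0\<close>.\<close>

lemma involution_word_nontrivial:
  fixes G (structure)
  assumes S: "bounded_distance_set S \<or> unbounded_distance_set S" "\<exists>s\<in>S. \<exists>t\<in>S. 0 < s \<and> s < t"
    and U: "S_Urysohn_space S U d"
    and hom: "homogeneous_action G U d \<phi>"
    and t: "t \<in> carrier G" "t \<otimes> t = \<one>" "\<exists>a\<in>U. \<phi> t a \<noteq> a"
    and "n > 0"
  obtains g where "g \<in> carrier G" "(t \<otimes> (inv g \<otimes> t \<otimes> g)) [^] (n :: nat) \<noteq> \<one>"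
proof -
  interpret group_action G U \<phi>
    using hom by (simp add: homogeneous_action_def acts_by_isometries_def)
  interpret G: group G
    using group_hom by (simp add: group_hom_def)
  have act: "\<phi> g x \<in> U" if "g \<in> carrier G" "x \<in> U" for g x
    using element_image that by blast
  have one: "\<phi> \<one> x = x" if "x \<in> U" for x
    using that by (metis id_eq_one restrict_apply')
  interpret Urysohn_involution S U d "\<phi> t"
  proof
    show "\<phi> t x \<in> U" if "x \<in> U" for x
      using act t that by blast
    show "\<phi> t (\<phi> t x) = x" if "x \<in> U" for x
      using composition_rule[OF that t(1) t(1)] one[OF that] t(2) by simp
    show "d (\<phi> t x) (\<phi> t y) = d x y" if "x \<in> U" "y \<in> U" for x y
      using hom t(1) that
      by (auto simp: homogeneous_action_def acts_by_isometries_def isometric_embedding_def)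
  qed (use S U t(3) in auto)
  obtain g p where g: "g \<in> carrier G" and pU: "p ` {..2 * n} \<subseteq> U" and p_inj: "inj_on p {..2 * n}"
    and Tg: "\<And>i. i < n \<Longrightarrow> \<phi> t (\<phi> g (p (2 * i))) = \<phi> g (p (2 * i + 1))"
    and Tp: "\<And>i. i < n \<Longrightarrow> \<phi> t (p (2 * i + 1)) = p (2 * i + 2)"
    using alternating_path[OF hom, of n] by blast
  have pj: "p j \<in> U" if "j \<le> 2 * n" for j
    using pU that by auto
  define w where "w = t \<otimes> (inv g \<otimes> t \<otimes> g)"
  have w: "w \<in> carrier G"
    using g t by (simp add: w_def)
  have step: "\<phi> w (p (2 * i)) = p (2 * i + 2)" if "i < n" for i
  proof -
    have i: "p (2 * i) \<in> U" "p (2 * i + 1) \<in> U"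
      using pj that by auto
    then have "\<phi> w (p (2 * i)) = \<phi> t (\<phi> (inv g) (\<phi> t (\<phi> g (p (2 * i)))))"
      using g t act by (simp add: w_def composition_rule G.m_assoc)
    also have "\<phi> (inv g) (\<phi> t (\<phi> g (p (2 * i)))) = p (2 * i + 1)"
      using Tg[OF that] orbit_sym_aux[OF g i(2)] by simp
    finally show ?thesis
      using Tp[OF that] by simp
  qed
  have "\<phi> (w [^] i) (p 0) = p (2 * i)" if "i \<le> n" for i
    using that
  proof (induction i)
    case 0
    then show ?case using one pj by simp
  next
    case (Suc i)
    then have "\<phi> (w [^] Suc i) (p 0) = \<phi> w (\<phi> (w [^] i) (p 0))"
      using composition_rule[of "p 0" w "w [^] i"] w pj by (simp only: G.nat_pow_Suc2) simp
    then show ?case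
      using Suc step[of i] by simp
  qed
  from this[of n] have "\<phi> (w [^] n) (p 0) = p (2 * n)"
    by simp
  moreover have "p (2 * n) \<noteq> p 0"
    using inj_onD[OF p_inj, of "2 * n" 0] \<open>n > 0\<close> by auto
  ultimately have "w [^] n \<noteq> \<one>"
    using one[of "p 0"] pj by auto
  then show thesis
    using that g by (simp add: w_def)
qed


section \<open>Permutations\<close>

lemma FinSym_nat_mult:
  assumes "f \<in> carrier FinSym_nat" "g \<in> carrier FinSym_nat"
  shows "f \<otimes>\<^bsub>FinSym_nat\<^esub> g = f \<circ> g"
  using assms by (auto simp: FinSym_nat_def BijGroup_def compose_def)

lemma FinSym_nat_one: "\<one>\<^bsub>FinSym_nat\<^esub> = id"
  by (auto simp: FinSym_nat_def BijGroup_def)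

lemma transpose_in_FinSym_nat: "Transposition.transpose m n \<in> carrier FinSym_nat"
proof -
  have "{k. Transposition.transpose m n k \<noteq> k} \<subseteq> {m, n}"
    by (auto simp: Transposition.transpose_def)
  then show ?thesis
    using finite_subset[of _ "{m, n}"] by (simp add: FinSym_nat_def Bij_def)
qed

text \<open>For the two transpositions \<open>s\<close> and \<open>u\<close>, both
  \<open>s u s\<close> and \<open>u s u\<close> exchange \<open>a\<close> and \<open>c\<close>, so
  the cube \<open>(s u s) (u s u)\<close> is the identity.\<close>

lemma transpose_braid:
  assumes "a \<noteq> b" "a \<noteq> c" "b \<noteq> c"
  defines "w \<equiv> Transposition.transpose a b \<circ> Transposition.transpose b c"
  shows "w (w (w x)) = x"
  using assms transpose_triple[of a c b] transpose_triple[of c a b]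
  by (simp add: transpose_commute[of b] transpose_commute[of a c])

text \<open>Disjoint transpositions commute, those sharing one point give a 3-cycle, and equal or
  degenerate pairs give order at most 2. The alternative is stated at each point, which is enough
  for the sixth power.\<close>

lemma transpose_product_order:
  defines "w a b c d \<equiv> Transposition.transpose a b \<circ> Transposition.transpose c d"
  shows "w a b c d (w a b c d x) = x \<or> w a b c d (w a b c d (w a b c d x)) = x"
proof -
  have sym: "w b a c d = w a b c d" "w a b d c = w a b c d" for a b c d
    by (simp_all add: w_def transpose_commute)
  have disjoint: "w a b c d (w a b c d x) = x" if "c \<noteq> a" "c \<noteq> b" "d \<noteq> a" "d \<noteq> b" for a b c d
    using transpose_apply_commute[of "Transposition.transpose c d" a b] that by (simp add: w_def)
  have overlap: "w a b b d (w a b b d x) = x \<or> w a b b d (w a b b d (w a b b d x)) = x" for a b d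
    using transpose_braid[of a b d x]
    by (cases "a = b"; cases "b = d"; cases "a = d") (auto simp: w_def transpose_commute[of b])
  show ?thesis
    using disjoint[of c a b d] overlap[of a b d] overlap[of b a d] overlap[of a b c] overlap[of b a c]
    by (metis sym)
qed

text \<open>Conjugation turns \<open>t\<close> into the transposition of the preimages of
  \<open>m\<close> and \<open>n\<close> under \<open>g\<close>, so the word is a product of two
  transpositions; 6 is a common multiple of 2 and 3.\<close>

lemma FinSym_nat_word_trivial:
  fixes m n :: nat
  assumes g: "g \<in> carrier FinSym_nat"
  defines "G \<equiv> FinSym_nat" and "t \<equiv> Transposition.transpose m n"
  shows "(t \<otimes>\<^bsub>G\<^esub> (inv\<^bsub>G\<^esub> g \<otimes>\<^bsub>G\<^esub> t \<otimes>\<^bsub>G\<^esub> g)) [^]\<^bsub>G\<^esub> (6 :: nat) = \<one>\<^bsub>G\<^esub>"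
proof -
  interpret G: group G
    unfolding G_def by (rule group_FinSym_nat)
  have g: "g \<in> carrier G" and t: "t \<in> carrier G"
    using g transpose_in_FinSym_nat by (auto simp: G_def t_def)
  have mult: "x \<otimes>\<^bsub>G\<^esub> y = x \<circ> y" if "x \<in> carrier G" "y \<in> carrier G" for x y
    using FinSym_nat_mult that by (simp add: G_def)
  have comp_closed: "x \<circ> y \<in> carrier G" if "x \<in> carrier G" "y \<in> carrier G" for x y
    using mult[OF that] G.m_closed[OF that] by simp
  define u where "u = inv\<^bsub>G\<^esub> g"
  have u: "u \<in> carrier G"
    using g by (simp add: u_def)
  have ug: "u \<circ> g = id"
    using G.l_inv[OF g] mult[OF u g] FinSym_nat_one by (simp add: u_def G_def)
  have "bij g"
    using g by (simp add: G_def FinSym_nat_def Bij_def)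
  then have conj: "u \<circ> t \<circ> g = Transposition.transpose (inv_into UNIV g m) (inv_into UNIV g n)"
    using transpose_comp_eq[of g m n] ug by (simp add: t_def comp_assoc) (metis comp_assoc id_comp)
  define w where "w = t \<circ> Transposition.transpose (inv_into UNIV g m) (inv_into UNIV g n)"
  have w: "t \<otimes>\<^bsub>G\<^esub> (inv\<^bsub>G\<^esub> g \<otimes>\<^bsub>G\<^esub> t \<otimes>\<^bsub>G\<^esub> g) = w"
    unfolding u_def[symmetric] using u g t transpose_in_FinSym_nat[folded G_def]
    by (simp add: w_def mult comp_closed conj)
  then have wG: "w \<in> carrier G"
    using g t by (metis G.inv_closed G.m_closed)
  have w6: "w (w (w (w (w (w k))))) = k" for k
    using transpose_product_order[of m n "inv_into UNIV g m" "inv_into UNIV g n"] unfolding w_def t_def by metis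
  have "w [^]\<^bsub>G\<^esub> (6 :: nat) = w \<circ> w \<circ> w \<circ> w \<circ> w \<circ> w"
    using wG by (simp add: numeral_eq_Suc mult comp_closed)
  also have "\<dots> = id"
    using w6 by (simp add: fun_eq_iff)
  finally show ?thesis
    using w FinSym_nat_one by (simp add: G_def)
qed

section \<open>The equidistant space and its isometry group\<close>

lemma BijGroup_iso:
  assumes b: "bij_betw b U V"
  shows "BijGroup U \<cong> BijGroup V"
proof -
  define c where "c = inv_into U b"
  have c: "bij_betw c V U"
    using bij_betw_inv_into[OF b] by (simp add: c_def)
  have bc: "c (b x) = x" if "x \<in> U" for x
    using that b by (simp add: c_def bij_betw_inv_into_left)
  have cb: "b (c y) = y" if "y \<in> V" for y
    using that b by (simp add: c_def bij_betw_inv_into_right)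
  have bV: "b x \<in> V" if "x \<in> U" for x
    using b that by (rule bij_betwE[THEN bspec])
  have cU: "c y \<in> U" if "y \<in> V" for y
    using c that by (rule bij_betwE[THEN bspec])
  \<comment> \<open>Conjugation by \<open>b\<close> and its inverse, restricted because the elements
    of \<open>Bij\<close> are extensional.\<close>
  define h where "h f = (\<lambda>y\<in>V. b (f (c y)))" for f
  define k where "k f = (\<lambda>x\<in>U. c (f (b x)))" for f
  have BijU: "f x \<in> U" if "f \<in> Bij U" "x \<in> U" for f x
    using Bij_imp_funcset[OF that(1)] that(2) by auto
  have BijV: "f x \<in> V" if "f \<in> Bij V" "x \<in> V" for f x
    using Bij_imp_funcset[OF that(1)] that(2) by auto
  have hB: "h f \<in> Bij V" if "f \<in> Bij U" for f
  proof -
    have "bij_betw (b \<circ> (f \<circ> c)) V V"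
      using that b c by (auto simp: Bij_def intro: bij_betw_trans)
    then have "bij_betw (h f) V V"
      by (rule bij_betw_cong[THEN iffD1, rotated]) (simp add: h_def)
    then show ?thesis
      by (simp add: Bij_def h_def)
  qed
  have kB: "k f \<in> Bij U" if "f \<in> Bij V" for f
  proof -
    have "bij_betw (c \<circ> (f \<circ> b)) U U"
      using that b c by (auto simp: Bij_def intro: bij_betw_trans)
    then have "bij_betw (k f) U U"
      by (rule bij_betw_cong[THEN iffD1, rotated]) (simp add: k_def)
    then show ?thesis
      by (simp add: Bij_def k_def)
  qed
  have "bij_betw h (Bij U) (Bij V)"
  proof (rule bij_betw_byWitness[where f' = k])
    show "\<forall>f\<in>Bij U. k (h f) = f"
    proof
      fix f assume f: "f \<in> Bij U"
      show "k (h f) = f"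
        by (rule extensionalityI[of _ U])
          (use f bc bV BijU Bij_imp_extensional in \<open>auto simp: k_def h_def\<close>)
    qed
    show "\<forall>f\<in>Bij V. h (k f) = f"
    proof
      fix f assume f: "f \<in> Bij V"
      show "h (k f) = f"
        by (rule extensionalityI[of _ V])
          (use f cb cU BijV Bij_imp_extensional in \<open>auto simp: k_def h_def\<close>)
    qed
  qed (use hB kB in auto)
  moreover have "h \<in> hom (BijGroup U) (BijGroup V)"
    using hB compose_Bij bc bV cU BijU
    by (auto simp: hom_def BijGroup_def h_def compose_def restrict_def fun_eq_iff)
  ultimately have "h \<in> iso (BijGroup U) (BijGroup V)"
    by (simp add: iso_def BijGroup_def)
  then show ?thesis
    by (auto simp: is_iso_def)
qed


text \<open>On a finite \<open>U\<close> the constant \<open>c\<close> would be a Katetov function,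
  realized by a point of \<open>U\<close> at distance \<open>c\<close> from itself.\<close>

lemma Urysohn_infinite:
  assumes U: "S_Urysohn_space S U d" and S: "0 \<in> S" "c \<in> S" "0 < c"
    and d: "\<forall>x\<in>U. \<forall>y\<in>U. x \<noteq> y \<longrightarrow> d x y = c"
  shows "infinite U"
proof
  assume "finite U"
  then obtain z where z: "z \<in> U" "\<And>x. x \<in> U \<Longrightarrow> d z x = c"
    using one_point_extension[OF U S(1), of U "\<lambda>_. c"] S d by auto
  moreover have "d z z = 0"
    using U z(1) by (simp add: S_Urysohn_space_def S_metric_space_def Metric_space.zero[of U d z z])
  ultimately show False
    using S(3) by force
qed

theorem theorem4:
  fixes S :: "real set" and U :: "'a set" and d :: "'a \<Rightarrow> 'a \<Rightarrow> real"
  assumes "bounded_distance_set S \<or> unbounded_distance_set S"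
    and "S_Urysohn_space S U d"
    and "in_class_H FinSym_nat U d"
  shows "card S = 2 \<and>
    (countable U \<and> infinite U \<and>
     (\<exists>c. \<forall>x\<in>U. \<forall>y\<in>U. x \<noteq> y \<longrightarrow> d x y = c) \<and>
     Iso_group U d \<cong> Sym_nat)"
proof -
  have "distance_values S"
    using assms(1) by (auto simp: bounded_distance_set_def unbounded_distance_set_def)
  then obtain c where S: "S \<subseteq> {0..}" "0 \<in> S" "c \<in> S" "0 < c"
    unfolding distance_values_def by (metis atLeast_iff order_le_less subsetD)
  obtain \<phi> where "faithful_action FinSym_nat U \<phi>" and hom: "homogeneous_action FinSym_nat U d \<phi>"
    using assms(3) by (auto simp: in_class_H_def)
  then interpret faithful_action FinSym_nat U \<phi>
    by simp
  interpret group FinSym_nat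
    by (rule group_FinSym_nat)
  define t where "t = Transposition.transpose (0 :: nat) 1"
  have t: "t \<in> carrier FinSym_nat"
    by (simp add: t_def transpose_in_FinSym_nat)
  have "t \<noteq> \<one>\<^bsub>FinSym_nat\<^esub>"
    by (auto simp: FinSym_nat_one t_def transpose_eq_id_iff)
  then have "\<phi> t \<noteq> (\<lambda>x\<in>U. x)"
    using inj_onD[OF faithful, of t "\<one>\<^bsub>FinSym_nat\<^esub>"] t id_eq_one by auto
  then have moved: "\<exists>a\<in>U. \<phi> t a \<noteq> a"
    using bij_prop0[OF t]
    by (metis Bij_imp_extensional extensionalityI restrict_apply' restrict_extensional)
  have square: "t \<otimes>\<^bsub>FinSym_nat\<^esub> t = \<one>\<^bsub>FinSym_nat\<^esub>"
    using t by (auto simp: FinSym_nat_mult FinSym_nat_one t_def)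
  \<comment> \<open>Two positive distances would give some \<open>g\<close> for which the sixth
    power of the word is nontrivial, whereas in \<open>FinSym_nat\<close> it is trivial for every
    \<open>g\<close>.\<close>
  have no_two: "\<not> (\<exists>s\<in>S. \<exists>t\<in>S. 0 < s \<and> s < t)"
  proof
    assume "\<exists>s\<in>S. \<exists>t\<in>S. 0 < s \<and> s < t"
    from involution_word_nontrivial[where G = FinSym_nat and \<phi> = \<phi> and t = t and n = 6,
        OF assms(1) this assms(2) hom t square moved]
    show False
      using FinSym_nat_word_trivial by (auto simp: t_def)
  qed
  have "x = c" if "x \<in> S" "x \<noteq> 0" for x
  proof -
    have "0 \<le> x"
      using S(1) that(1) by auto
    then have "0 < x"
      using that(2) by simp
    then show ?thesis
      using no_two S(3,4) that(1) by (metis linorder_neqE)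
  qed
  then have "S = {0, c}"
    using S(2,3) by auto
  then have "card S = 2"
    using S by simp
  have "Metric_space U d" "\<forall>x\<in>U. \<forall>y\<in>U. d x y \<in> S" "countable U"
    using assms(2) by (auto simp: S_Urysohn_space_def S_metric_space_def)
  then have d: "d x y = (if x = y then 0 else c)" if "x \<in> U" "y \<in> U" for x y
    using that Metric_space.zero[of U d x y] \<open>S = {0, c}\<close> by auto
  then have const: "\<forall>x\<in>U. \<forall>y\<in>U. x \<noteq> y \<longrightarrow> d x y = c"
    by simp
  then have "infinite U"
    using Urysohn_infinite[OF assms(2) S(2-4)] by blast
  then have "bij_betw (to_nat_on U) U UNIV"
    using \<open>countable U\<close> by (rule to_nat_on_infinite[rotated])
  then have "BijGroup U \<cong> Sym_nat"
    by (rule BijGroup_iso)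
  \<comment> \<open>With a single positive distance every injective map preserves distances.\<close>
  moreover have "Iso_group U d = BijGroup U"
  proof -
    have "isometric_embedding U d U d f" if "f \<in> Bij U" for f
      using that d Bij_imp_funcset[OF that]
      by (auto simp: isometric_embedding_def Bij_def bij_betw_def Pi_iff inj_on_eq_iff)
    then have "{f \<in> Bij U. isometric_embedding U d U d f} = Bij U"
      by auto
    then show ?thesis
      by (simp add: Iso_group_def BijGroup_def)
  qed
  ultimately show ?thesis
    using \<open>card S = 2\<close> \<open>countable U\<close> \<open>infinite U\<close> const by auto
qed

end
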